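(* Let $f\in\mathcal C^1(\mathbb R^n)$ be $L$-Lipschitz smooth with $f_\star=\inf f>-\infty$. Assume that the stochastic gradient oracle satisfies $\mathbb E_\xi[\nabla f(x,\xi)]=\nabla f(x)$ and $\mathbb E_\xi[\|\nabla f(x,\xi)-\nabla f(x)\|^p]\le\sigma^p$ for all $x\in\mathbb R^n$, for some $\sigma\ge0$ and $p\in(1,2]$. Let $\kappa>2$, $\varepsilon>0$, and let $\nabla\phi^*:\mathbb R^n\to\mathbb R^n$ be given by $$\nabla\phi^*(y)_i=\frac{y_i}{(\varepsilon^\kappa+|y_i|^\kappa)^{1/\kappa}},\qquad i=1,\dots,n.$$ For $K\in\mathbb N$ put $\alpha=(K+1)^{-1/2}$ and $\gamma=(K+1)^{-3/4}$, and let $0<\epsilon\le(K+1)^{-\min\{\frac14,\frac{p-1}{2p}\}}$. Let $\{x^k\}$ be generated from $x^0\in\mathbb R^n$ by $$x^{k+1}=x^k-\gamma\nabla\phi^*(d^k_\epsilon),\qquad d^k_\epsilon=\frac{d^k}{\|d^k\|+\epsilon},$$ with $d^0=\nabla f(x^0,\xi^0)$ and $d^k=\alpha\nabla f(x^k,\xi^k)+(1-\alpha)d^{k-1}$ for $k\ge1$. Then $$\frac1{K+1}\sum_{k=0}^K\mathbb E[\|\nabla f(x^k)\|]\le O\left((K+1)^{-\min\left\{\frac14,\frac{p-1}{2p}\right\}}\right),$$ where the constant hidden in $O(\cdot)$ does not depend on $K$.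
   Context: $\|\cdot\|$ is the Euclidean norm. $f$ is $L$-Lipschitz smooth ($L>0$) if $\|\nabla f(x)-\nabla f(\bar x)\|\le L\|x-\bar x\|$ for all $x,\bar x$. The samples $\xi^0,\xi^1,\dots$ are independent copies of the random variable $\xi$, $\xi^k$ being drawn at iteration $k$ independently of the past; $\mathbb E$ denotes total expectation. The parameter $\varepsilon$ (part of the preconditioner) is fixed, and is different from the normalization parameter $\epsilon$, which may depend on $K$. Here $\phi^*$ is the convex conjugate of a separable reference function $\phi(x)=\sum_{i=1}^n h_\kappa(x_i)$, but only the displayed formula for $\nabla\phi^*$ enters the algorithm. *)

theory Defs
  imports "HOL-Analysis.Analysis" "HOL-Probability.Probability"
begin

definition nabla_phi_conj :: "real \<Rightarrow> real \<Rightarrow> real ^ 'n \<Rightarrow> real ^ 'n" where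
  "nabla_phi_conj \<kappa> \<epsilon> y = (\<chi> i. y $ i / (\<epsilon> powr \<kappa> + \<bar>y $ i\<bar> powr \<kappa>) powr (1 / \<kappa>))"

definition lipschitz_smooth_with_gradient ::
  "real \<Rightarrow> ('a::real_inner \<Rightarrow> real) \<Rightarrow> ('a \<Rightarrow> 'a) \<Rightarrow> bool" where
  "lipschitz_smooth_with_gradient L f nabla_f \<longleftrightarrow>
     (\<forall>x. GDERIV f x :> nabla_f x) \<and> continuous_on UNIV nabla_f \<and>
     (\<forall>x y. norm (nabla_f x - nabla_f y) \<le> L * norm (x - y))"

(* The measure D is the law of the random variable \<xi>. The oracle g x s, with s a value of \<xi>,
   is an arbitrary jointly measurable map: g need not be a gradient in x.
   Integrability is required explicitly because non-integrable functions have Bochner integral 0. *)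
definition unbiased_oracle ::
  "'b measure \<Rightarrow> (real ^ 'n \<Rightarrow> 'b \<Rightarrow> real ^ 'n) \<Rightarrow> (real ^ 'n \<Rightarrow> real ^ 'n) \<Rightarrow> real \<Rightarrow> real \<Rightarrow> bool"
where
  "unbiased_oracle D g nabla_f \<sigma> p \<longleftrightarrow>
     prob_space D \<and>
     (\<lambda>(x, s). g x s) \<in> borel_measurable (borel \<Otimes>\<^sub>M D) \<and>
     (\<forall>x. integrable D (g x) \<and> (\<integral>s. g x s \<partial>D) = nabla_f x) \<and>
     (\<forall>x. integrable D (\<lambda>s. norm (g x s - nabla_f x) powr p) \<and>
          (\<integral>s. norm (g x s - nabla_f x) powr p \<partial>D) \<le> \<sigma> powr p)"

definition iid_samples :: "'w measure \<Rightarrow> 'b measure \<Rightarrow> (nat \<Rightarrow> 'w \<Rightarrow> 'b) \<Rightarrow> bool" where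
  "iid_samples M D \<xi> \<longleftrightarrow>
     prob_space M \<and> prob_space.indep_vars M (\<lambda>_. D) \<xi> UNIV \<and> (\<forall>k. distr M D (\<xi> k) = D)"

(* Here \<delta> is the normalization parameter and Psi the preconditioner. *)
definition momentum_run ::
  "'w measure \<Rightarrow> (nat \<Rightarrow> 'w \<Rightarrow> 'b) \<Rightarrow> ('a::real_normed_vector \<Rightarrow> 'b \<Rightarrow> 'a) \<Rightarrow> ('a \<Rightarrow> 'a) \<Rightarrow>
   real \<Rightarrow> real \<Rightarrow> real \<Rightarrow> 'a \<Rightarrow> (nat \<Rightarrow> 'w \<Rightarrow> 'a) \<Rightarrow> (nat \<Rightarrow> 'w \<Rightarrow> 'a) \<Rightarrow> bool"
where
  "momentum_run M \<xi> g Psi \<alpha> \<gamma> \<delta> x0 x d \<longleftrightarrow>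
     (\<forall>\<omega>\<in>space M.
        x 0 \<omega> = x0 \<and>
        d 0 \<omega> = g x0 (\<xi> 0 \<omega>) \<and>
        (\<forall>k. x (Suc k) \<omega> = x k \<omega> - \<gamma> *\<^sub>R Psi (d k \<omega> /\<^sub>R (norm (d k \<omega>) + \<delta>))) \<and>
        (\<forall>k. d (Suc k) \<omega> =
               \<alpha> *\<^sub>R g (x (Suc k) \<omega>) (\<xi> (Suc k) \<omega>) + (1 - \<alpha>) *\<^sub>R d k \<omega>))"

end

theory Submission
  imports Defs
begin

text \<open>
  Write \<open>e k = d k - nabla_f (x k)\<close> for the error of the momentum buffer. Normalization keeps the
  argument \<open>y\<close> of the preconditioner \<open>\<Psi>\<close> in the unit ball, and there \<open>\<Psi>\<close> behaves like a multiple
  of the identity: \<open>norm (\<Psi> y) \<le> B\<close> and \<open>c * (norm y)\<^sup>2 \<le> y \<bullet> \<Psi> y\<close>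
  with \<open>B = 1 / \<epsilon>\<close> and \<open>c = 1 / (\<epsilon> powr \<kappa> + 1) powr (1 / \<kappa>)\<close>
  (\<open>norm_nabla_phi_conj_le\<close>, \<open>inner_nabla_phi_conj_ge\<close>). Hence each step has length at most
  \<open>\<gamma> * B\<close>, and along every sample path the smoothness of \<open>f\<close> makes the step decrease \<open>f\<close> by at least
  \<open>\<gamma> * c * norm (nabla_f (x k))\<close>, up to a multiple of \<open>\<gamma> * norm (e k)\<close>, the bias
  \<open>\<gamma> * c * \<delta>\<close> and a second order term in \<open>\<gamma>\<close> (\<open>momentum_run_gradient_sum_le\<close>).
  Telescoping reduces the theorem to a bound on the average of the means of \<open>norm (e k)\<close>.

  The error obeys \<open>e (k+1) = (1 - \<alpha>) * (e k + drift) + \<alpha> * noise\<close>, where the drift of the gradient is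
  at most \<open>L * \<gamma> * B\<close>. Variances may be infinite, so one follows the \<open>p\<close>-th moment
  instead of the second. Two facts replace the orthogonality of martingale increments:
  the inequality \<open>norm_powr_add_le\<close> bounds \<open>norm (a + b) powr p\<close> by \<open>norm a powr p\<close>, a term linear in
  \<open>b\<close>, and \<open>6 * norm b powr p\<close>; and the linear term has mean zero because the pair
  formed by the current point and the old buffer is independent of the next sample
  (\<open>adapted_state_indep_next\<close>). Independence is used through Fubini's theorem on a product
  measure (\<open>indep_oracle_noise_moment_le\<close>), so that no conditional expectation appears.
  With convexity of the \<open>p\<close>-th power for the drift this gives an affine recursion that contracts by
  \<open>1 - \<alpha>\<close>, whose solution is \<open>momentum_error_moment_le\<close>.

  To pass from \<open>p\<close>-th moments to means, \<open>t \<le> r + t powr p / r powr (p - 1)\<close> is used with \<open>r\<close> equal to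
  the target rate. With \<open>T = K + 1\<close>, \<open>\<alpha> = T powr (-1/2)\<close> and \<open>\<gamma> = T powr (-3/4)\<close> the
  three parts of the averaged \<open>p\<close>-th moment are of order \<open>T powr (-1/2)\<close> (initial error),
  \<open>T powr (-p/4)\<close> (drift) and \<open>T powr (-(p-1)/2)\<close> (noise); each of these powers is at most
  \<open>r powr p\<close>.
\<close>

section \<open>The descent inequality\<close>

text \<open>The mean value theorem along the segment gives the constant \<open>L\<close>; integrating along the segment
  would give \<open>L / 2\<close>, a gain that only affects constants below.\<close>

lemma lipschitz_smooth_descent:
  fixes f :: "'a::real_inner \<Rightarrow> real"
  assumes "lipschitz_smooth_with_gradient L f nabla_f"
  shows "f (x + h) \<le> f x + nabla_f x \<bullet> h + L * (norm h)\<^sup>2"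
proof -
  have G: "\<And>x. (f has_derivative (\<lambda>h. h \<bullet> nabla_f x)) (at x)"
    and Lip: "\<And>x y. norm (nabla_f x - nabla_f y) \<le> L * norm (x - y)"
    using assms unfolding lipschitz_smooth_with_gradient_def gderiv_def by auto
  have "\<exists>t\<in>{0<..<1::real}. f (x + 1 *\<^sub>R h) - f (x + 0 *\<^sub>R h) = ((1 - 0) *\<^sub>R h) \<bullet> nabla_f (x + t *\<^sub>R h)"
  proof (rule mvt_simple)
    fix t :: real
    have "((\<lambda>t. x + t *\<^sub>R h) has_derivative (\<lambda>s. s *\<^sub>R h)) (at t within {0..1})"
      by (auto intro!: derivative_eq_intros)
    from has_derivative_compose[OF this G]
    show "((\<lambda>t. f (x + t *\<^sub>R h)) has_derivative (\<lambda>s. (s *\<^sub>R h) \<bullet> nabla_f (x + t *\<^sub>R h)))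
            (at t within {0..1})" .
  qed simp
  then obtain t :: real where t: "0 < t" "t < 1" and "f (x + h) - f x = h \<bullet> nabla_f (x + t *\<^sub>R h)"
    by auto
  then have "f (x + h) - f x = nabla_f x \<bullet> h + (nabla_f (x + t *\<^sub>R h) - nabla_f x) \<bullet> h"
    by (simp add: inner_commute[of h] inner_diff_left)
  also have "(nabla_f (x + t *\<^sub>R h) - nabla_f x) \<bullet> h \<le> norm (nabla_f (x + t *\<^sub>R h) - nabla_f x) * norm h"
    by (rule norm_cauchy_schwarz)
  also have "\<dots> \<le> (L * norm h) * norm h"
  proof (rule mult_right_mono)
    have "L * norm (x - (x + h)) \<ge> 0"
      by (rule order_trans[OF norm_ge_zero Lip])
    then have "t * (L * norm h) \<le> 1 * (L * norm h)"
      using t by (intro mult_right_mono) auto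
    moreover have "norm (nabla_f (x + t *\<^sub>R h) - nabla_f x) \<le> t * (L * norm h)"
      using Lip[of "x + t *\<^sub>R h" x] t by (simp add: mult_ac)
    ultimately show "norm (nabla_f (x + t *\<^sub>R h) - nabla_f x) \<le> L * norm h" by simp
  qed simp
  finally show ?thesis by (simp add: power2_eq_square)
qed

section \<open>The preconditioner on the unit ball\<close>

text \<open>Each denominator is at least \<open>\<epsilon>\<close>.\<close>

lemma norm_nabla_phi_conj_le:
  fixes y :: "real ^ 'n"
  assumes "\<kappa> > 0" "\<epsilon> > 0"
  shows "norm (nabla_phi_conj \<kappa> \<epsilon> y) \<le> norm y / \<epsilon>"
proof -
  have "norm (nabla_phi_conj \<kappa> \<epsilon> y) \<le> norm ((1 / \<epsilon>) *\<^sub>R y)"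
  proof (rule norm_le_componentwise_cart)
    fix i
    have "\<epsilon> = (\<epsilon> powr \<kappa>) powr (1 / \<kappa>)"
      using assms by (simp add: powr_powr)
    also have "\<dots> \<le> (\<epsilon> powr \<kappa> + \<bar>y $ i\<bar> powr \<kappa>) powr (1 / \<kappa>)"
      using assms by (intro powr_mono2) auto
    finally show "norm (nabla_phi_conj \<kappa> \<epsilon> y $ i) \<le> norm (((1 / \<epsilon>) *\<^sub>R y) $ i)"
      using assms by (auto simp: nabla_phi_conj_def abs_mult intro!: divide_left_mono mult_pos_pos)
  qed
  then show ?thesis using assms by simp
qed

text \<open>In the unit ball every denominator is at most \<open>(\<epsilon> powr \<kappa> + 1) powr (1 / \<kappa>)\<close>.\<close>

lemma inner_nabla_phi_conj_ge:
  fixes y :: "real ^ 'n"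
  assumes "\<kappa> > 0" "\<epsilon> > 0" "norm y \<le> 1"
  shows "(norm y)\<^sup>2 / (\<epsilon> powr \<kappa> + 1) powr (1 / \<kappa>) \<le> y \<bullet> nabla_phi_conj \<kappa> \<epsilon> y"
proof -
  have "(y $ i)\<^sup>2 / (\<epsilon> powr \<kappa> + 1) powr (1 / \<kappa>) \<le> y $ i * nabla_phi_conj \<kappa> \<epsilon> y $ i" for i
  proof -
    have "\<bar>y $ i\<bar> powr \<kappa> \<le> 1 powr \<kappa>"
      using assms component_le_norm_cart[of y i] by (intro powr_mono2) auto
    then have "(\<epsilon> powr \<kappa> + \<bar>y $ i\<bar> powr \<kappa>) powr (1 / \<kappa>) \<le> (\<epsilon> powr \<kappa> + 1) powr (1 / \<kappa>)"
      using assms by (intro powr_mono2) auto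
    moreover have "0 < (\<epsilon> powr \<kappa> + \<bar>y $ i\<bar> powr \<kappa>) powr (1 / \<kappa>)"
      using assms by (smt (verit) powr_gt_zero powr_ge_zero)
    ultimately have "(y $ i)\<^sup>2 / (\<epsilon> powr \<kappa> + 1) powr (1 / \<kappa>)
        \<le> (y $ i)\<^sup>2 / (\<epsilon> powr \<kappa> + \<bar>y $ i\<bar> powr \<kappa>) powr (1 / \<kappa>)"
      by (intro divide_left_mono mult_pos_pos) auto
    then show ?thesis
      by (simp add: nabla_phi_conj_def power2_eq_square)
  qed
  then have "(\<Sum>i\<in>UNIV. (y $ i)\<^sup>2 / (\<epsilon> powr \<kappa> + 1) powr (1 / \<kappa>))
      \<le> (\<Sum>i\<in>UNIV. y $ i * nabla_phi_conj \<kappa> \<epsilon> y $ i)"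
    by (intro sum_mono)
  then show ?thesis
    by (simp add: inner_vec_def power2_norm_eq_inner sum_divide_distrib[symmetric] power2_eq_square[of "y $ _"])
qed

lemma borel_measurable_nabla_phi_conj:
  assumes "\<kappa> > 0" "\<epsilon> > 0"
  shows "(nabla_phi_conj \<kappa> \<epsilon> :: real ^ 'n \<Rightarrow> _) \<in> borel_measurable borel"
proof (rule borel_measurable_continuous_onI)
  have "0 < \<epsilon> powr \<kappa> + \<bar>u\<bar> powr \<kappa>" for u :: real
    using assms by (smt (verit) powr_gt_zero powr_ge_zero)
  then show "continuous_on UNIV (nabla_phi_conj \<kappa> \<epsilon> :: real ^ 'n \<Rightarrow> _)"
    unfolding nabla_phi_conj_def using assms
    by (intro continuous_intros continuous_on_powr') (auto simp: less_imp_le less_imp_neq[symmetric] )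
qed

text \<open>Normalizing with \<open>\<delta> > 0\<close> costs only the additive constant \<open>\<delta>\<close>, because
  \<open>n\<^sup>2 / (n + \<delta>) \<ge> n - \<delta>\<close> for \<open>n \<ge> 0\<close>.\<close>

lemma normalized_inner_ge:
  fixes v :: "'a::real_inner"
  assumes "\<delta> > 0" "c \<ge> 0"
    and "\<forall>y. norm y \<le> 1 \<longrightarrow> c * (norm y)\<^sup>2 \<le> y \<bullet> \<Psi> y"
  shows "c * (norm v - \<delta>) \<le> v \<bullet> \<Psi> (v /\<^sub>R (norm v + \<delta>))"
proof -
  define s where "s = norm v + \<delta>"
  define y where "y = v /\<^sub>R s"
  have s: "s > 0" using assms by (simp add: s_def add_nonneg_pos)
  have ny: "norm y = norm v / s" using s by (simp add: y_def divide_inverse)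
  have "norm y \<le> 1" using s assms by (simp add: ny s_def)
  then have "s * (c * (norm y)\<^sup>2) \<le> s * (y \<bullet> \<Psi> y)"
    using s assms(3) by (intro mult_left_mono) auto
  also have "\<dots> = v \<bullet> \<Psi> y" using s by (simp add: y_def)
  also have "s * (c * (norm y)\<^sup>2) = c * ((norm v)\<^sup>2 / s)"
    using s by (simp add: ny power2_eq_square)
  finally have "c * ((norm v)\<^sup>2 / s) \<le> v \<bullet> \<Psi> y" .
  moreover have "(norm v - \<delta>) * s \<le> (norm v)\<^sup>2"
    by (simp add: s_def power2_eq_square algebra_simps)
  then have "norm v - \<delta> \<le> (norm v)\<^sup>2 / s"
    using s by (simp add: pos_le_divide_eq)
  then have "c * (norm v - \<delta>) \<le> c * ((norm v)\<^sup>2 / s)"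
    using assms by (intro mult_left_mono)
  ultimately show ?thesis by (simp add: y_def s_def)
qed

section \<open>Inequalities for powers with exponent between one and two\<close>

lemma powr_le_linear:
  fixes v q :: real
  assumes "v \<ge> 0" "0 < q" "q \<le> 1"
  shows "v powr q \<le> q * v + (1 - q)"
proof (cases "v = 0")
  case False
  then show ?thesis using Youngs_inequality_0[of q "1 - q" v 1] assms by simp
qed (use assms in simp)

text \<open>The graph of the concave function \<open>\<lambda>v. v powr (p / 2)\<close> lies below its tangent at \<open>u\<close>. For
  \<open>v\<close> and \<open>u\<close> squared norms this is an expansion of the \<open>p\<close>-th power of a norm.\<close>

lemma powr_half_tangent:
  fixes u v p :: real
  assumes "v \<ge> 0" "u > 0" "0 < p" "p \<le> 2"
  shows "v powr (p / 2) \<le> u powr (p / 2) + p / 2 * u powr (p / 2 - 1) * (v - u)"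
proof -
  have "v powr (p/2) = u powr (p/2) * (v / u) powr (p/2)"
    using assms by (simp add: powr_divide)
  also have "\<dots> \<le> u powr (p/2) * (p/2 * (v / u) + (1 - p/2))"
    using assms by (intro mult_left_mono powr_le_linear) auto
  also have "\<dots> = u powr (p / 2) + p / 2 * (u powr (p / 2) / u) * (v - u)"
    using assms by (simp add: field_simps)
  also have "u powr (p / 2) / u = u powr (p / 2 - 1)"
    using assms by (simp add: powr_diff)
  finally show ?thesis .
qed

text \<open>This takes the place of the expansion of \<open>(norm (a + b))\<^sup>2\<close>; since \<open>w\<close> depends only on
  \<open>a\<close>, the cross term vanishes in the mean for centred \<open>b\<close> independent of \<open>a\<close>. One takes
  \<open>w = p * norm a powr (p - 2)\<close>, from the derivative of \<open>norm a powr p\<close>. If \<open>b\<close> is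
  shorter than \<open>a\<close>, concavity of \<open>\<lambda>v. v powr (p / 2)\<close> leaves the remainder
  \<open>p / 2 * norm a powr (p - 2) * (norm b)\<^sup>2\<close>, at most \<open>norm b powr p\<close>. Otherwise all terms are of
  the order of \<open>norm b powr p\<close>, and the constant is \<open>4\<close> from \<open>norm (a + b) powr p\<close> plus \<open>2\<close> from the
  cross term.\<close>

lemma norm_powr_add_le:
  fixes a :: "'a::real_inner"
  assumes p: "1 < p" "p \<le> 2"
  shows "\<exists>w. \<forall>b. norm (a + b) powr p \<le> norm a powr p + w * (a \<bullet> b) + 6 * norm b powr p"
proof (cases "a = 0")
  case True
  then show ?thesis by auto
next
  case False
  define A where "A = norm a"
  have A: "A > 0" using False by (simp add: A_def)
  define w where "w = p * A powr (p - 2)"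
  have w: "w \<ge> 0" using p by (simp add: w_def)
  have "norm (a + b) powr p \<le> A powr p + w * (a \<bullet> b) + 6 * norm b powr p" for b
  proof (cases "norm b \<le> A")
    case True
    have sq: "(r\<^sup>2) powr (q / 2) = r powr q" if "r \<ge> 0" for r q :: real
      using that by (cases "r = 0") (simp_all add: powr_powr flip: powr_numeral)
    have e: "p / 2 - 1 = (p - 2) / 2" by simp
    have "norm (a + b) powr p = ((norm (a + b))\<^sup>2) powr (p / 2)"
      by (simp add: sq)
    also have "\<dots> \<le> (A\<^sup>2) powr (p / 2)
        + p / 2 * (A\<^sup>2) powr (p / 2 - 1) * ((norm (a + b))\<^sup>2 - A\<^sup>2)"
      using A p by (intro powr_half_tangent) auto
    also have "(norm (a + b))\<^sup>2 - A\<^sup>2 = 2 * (a \<bullet> b) + (norm b)\<^sup>2"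
      by (simp add: A_def power2_norm_eq_inner inner_add_left inner_add_right inner_commute)
    also have "(A\<^sup>2) powr (p / 2) = A powr p" using A by (simp add: sq)
    also have "(A\<^sup>2) powr (p / 2 - 1) = A powr (p - 2)" unfolding e using A by (subst sq) auto
    also have "A powr p + p / 2 * A powr (p - 2) * (2 * (a \<bullet> b) + (norm b)\<^sup>2)
        = A powr p + w * (a \<bullet> b) + p / 2 * (A powr (p - 2) * (norm b)\<^sup>2)"
      by (simp add: w_def algebra_simps)
    also have "A powr (p - 2) * (norm b)\<^sup>2 \<le> norm b powr p"
    proof (cases "b = 0")
      case b: False
      have "A powr (p - 2) \<le> norm b powr (p - 2)"
        using True b p by (intro powr_mono2') auto
      then have "A powr (p - 2) * (norm b)\<^sup>2 \<le> norm b powr (p - 2) * (norm b)\<^sup>2"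
        by (intro mult_right_mono) auto
      also have "\<dots> = norm b powr p"
        using b by (simp add: powr_diff)
      finally show ?thesis .
    qed simp
    then have "p / 2 * (A powr (p - 2) * (norm b)\<^sup>2) \<le> 6 * norm b powr p"
      using p by (intro mult_mono) auto
    finally show ?thesis by simp
  next
    case False
    have "norm (a + b) \<le> 2 * norm b"
      using norm_triangle_ineq[of a b] False by (simp add: A_def)
    then have "norm (a + b) powr p \<le> (2 * norm b) powr p"
      using p by (intro powr_mono2) auto
    also have "\<dots> = 2 powr p * norm b powr p" by (simp add: powr_mult)
    also have "2 powr p \<le> (2::real) powr 2" using p by (intro powr_mono) auto
    finally have 1: "norm (a + b) powr p \<le> 4 * norm b powr p" by (simp add: mult_right_mono)
    have "- (w * (a \<bullet> b)) = w * (- (a \<bullet> b))" by simp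
    also have "\<dots> \<le> w * (A * norm b)"
      using w norm_cauchy_schwarz[of a "- b"] by (intro mult_left_mono) (auto simp: A_def)
    also have "\<dots> = p * (A powr (p - 1) * norm b)"
      using A by (simp add: w_def powr_diff power2_eq_square)
    also have "\<dots> \<le> 2 * (norm b powr (p - 1) * norm b)"
      using p A False by (intro mult_mono powr_mono2) auto
    also have "norm b powr (p - 1) * norm b = norm b powr p"
      using False A by (cases "b = 0") (auto simp: powr_diff)
    finally have "- (w * (a \<bullet> b)) \<le> 2 * norm b powr p" .
    moreover have "0 \<le> A powr p" by simp
    ultimately show ?thesis using 1 by linarith
  qed
  then show ?thesis unfolding A_def by blast
qed

text \<open>If \<open>u\<close> or \<open>v\<close> is zero, a point not covered by \<open>powr_convex\<close>, the claim reduces to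
  \<open>s powr p \<le> s\<close> for \<open>s\<close> in the unit interval.\<close>

lemma powr_convex_combination_le:
  fixes u v t p :: real
  assumes p: "1 \<le> p" and "0 \<le> t" "t \<le> 1" "0 \<le> u" "0 \<le> v"
  shows "((1 - t) * u + t * v) powr p \<le> (1 - t) * u powr p + t * v powr p"
proof -
  have *: "(s * r) powr p \<le> s * r powr p" if "0 \<le> s" "s \<le> 1" "0 \<le> r" for s r :: real
  proof -
    have "s powr p \<le> s"
    proof (cases "s = 0")
      case False
      then show ?thesis using that p powr_mono'[of 1 p s] by simp
    qed simp
    then show ?thesis by (simp add: powr_mult mult_right_mono)
  qed
  consider "u = 0" | "v = 0" | "u > 0" "v > 0" using assms by linarith
  then show ?thesis
  proof cases
    case 1 then show ?thesis using *[of t v] assms by simp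
  next
    case 2 then show ?thesis using *[of "1 - t" u] assms by simp
  next
    case 3
    then show ?thesis using convex_onD[OF powr_convex[OF p], of t u v] assms by simp
  qed
qed

text \<open>Either \<open>t \<le> r\<close>, or \<open>1 \<le> (t / r) powr (p - 1)\<close>. The free parameter \<open>r\<close> makes this as good as
  Lyapunov's inequality up to a constant, without taking \<open>p\<close>-th roots of moment bounds.\<close>

lemma le_add_powr_div:
  fixes t r p :: real
  assumes "t \<ge> 0" "r > 0" "p \<ge> 1"
  shows "t \<le> r + t powr p / r powr (p - 1)"
proof (cases "t \<le> r")
  case True
  moreover have "0 \<le> t powr p / r powr (p - 1)" by simp
  ultimately show ?thesis by linarith
next
  case False
  have "r powr (p - 1) \<le> t powr (p - 1)" using assms False by (intro powr_mono2) auto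
  then have "t * r powr (p - 1) \<le> t * t powr (p - 1)" using assms by (intro mult_left_mono)
  also have "\<dots> = t powr p" using assms False by (simp add: powr_diff)
  finally have "t \<le> t powr p / r powr (p - 1)" using assms by (simp add: pos_le_divide_eq)
  then show ?thesis using assms by linarith
qed

section \<open>Independence of the state and the next sample\<close>

text \<open>The state \<open>Y k\<close> is a measurable function of the samples before time \<open>k\<close>, and the tuple of these is
  independent of the sample at time \<open>k\<close>. Independence is expressed by the joint law because the
  two variables take values in different types.\<close>

lemma (in prob_space) adapted_state_indep_next:
  assumes indep: "indep_vars (\<lambda>_. D) \<xi> UNIV"
    and h: "\<And>k. (\<lambda>(y, s). h k y s) \<in> measurable (N \<Otimes>\<^sub>M D) N"
    and y0: "y0 \<in> space N"
    and Y0: "\<And>\<omega>. \<omega> \<in> space M \<Longrightarrow> Y 0 \<omega> = y0"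
    and YS: "\<And>k \<omega>. \<omega> \<in> space M \<Longrightarrow> Y (Suc k) \<omega> = h k (Y k \<omega>) (\<xi> k \<omega>)"
  shows "Y k \<in> measurable M N"
    and "distr M N (Y k) \<Otimes>\<^sub>M distr M D (\<xi> k) = distr M (N \<Otimes>\<^sub>M D) (\<lambda>\<omega>. (Y k \<omega>, \<xi> k \<omega>))"
proof -
  define past where "past k \<omega> = (\<lambda>i\<in>{..<k}. \<xi> i \<omega>)" for k :: nat and \<omega>
  have "\<exists>F. F \<in> measurable (\<Pi>\<^sub>M i\<in>{..<k}. D) N \<and> (\<forall>\<omega>\<in>space M. Y k \<omega> = F (past k \<omega>))"
  proof (induction k)
    case 0
    show ?case using y0 Y0 by (intro exI[of _ "\<lambda>_. y0"]) auto
  next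
    case (Suc k)
    then obtain F where F[measurable]: "F \<in> measurable (\<Pi>\<^sub>M i\<in>{..<k}. D) N"
      and YF: "\<And>\<omega>. \<omega> \<in> space M \<Longrightarrow> Y k \<omega> = F (past k \<omega>)" by blast
    have [measurable]: "(\<lambda>s. restrict s {..<k}) \<in> measurable (\<Pi>\<^sub>M i\<in>{..<Suc k}. D) (\<Pi>\<^sub>M i\<in>{..<k}. D)"
      by (rule measurable_restrict_subset) auto
    have [measurable]: "(\<lambda>s. s k) \<in> measurable (\<Pi>\<^sub>M i\<in>{..<Suc k}. D) D"
      by (rule measurable_component_singleton) auto
    have "(\<lambda>s. (F (restrict s {..<k}), s k)) \<in> measurable (\<Pi>\<^sub>M i\<in>{..<Suc k}. D) (N \<Otimes>\<^sub>M D)"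
      by measurable
    from measurable_compose[OF this h[of k]]
    have "(\<lambda>s. h k (F (restrict s {..<k})) (s k)) \<in> measurable (\<Pi>\<^sub>M i\<in>{..<Suc k}. D) N"
      by simp
    moreover have "restrict (past (Suc k) \<omega>) {..<k} = past k \<omega>" for \<omega>
      by (auto simp: past_def restrict_def)
    moreover have "past (Suc k) \<omega> k = \<xi> k \<omega>" for \<omega>
      by (simp add: past_def)
    ultimately show ?case
      by (intro exI[of _ "\<lambda>s. h k (F (restrict s {..<k})) (s k)"]) (simp add: YS YF)
  qed
  then obtain F where F: "F \<in> measurable (\<Pi>\<^sub>M i\<in>{..<k}. D) N"
    and YF: "\<And>\<omega>. \<omega> \<in> space M \<Longrightarrow> Y k \<omega> = F (past k \<omega>)" by blast
  define now where "now \<omega> = (\<lambda>i\<in>{k}. \<xi> i \<omega>)" for \<omega>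
  have "indep_var (\<Pi>\<^sub>M i\<in>{..<k}. D) (past k) (\<Pi>\<^sub>M i\<in>{k}. D) now"
    unfolding past_def now_def by (rule indep_var_restrict[OF indep]) auto
  then have past[measurable]: "past k \<in> measurable M (\<Pi>\<^sub>M i\<in>{..<k}. D)"
    and now[measurable]: "now \<in> measurable M (\<Pi>\<^sub>M i\<in>{k}. D)"
    and joint: "distr M (\<Pi>\<^sub>M i\<in>{..<k}. D) (past k) \<Otimes>\<^sub>M distr M (\<Pi>\<^sub>M i\<in>{k}. D) now
      = distr M ((\<Pi>\<^sub>M i\<in>{..<k}. D) \<Otimes>\<^sub>M (\<Pi>\<^sub>M i\<in>{k}. D)) (\<lambda>\<omega>. (past k \<omega>, now \<omega>))"
    unfolding indep_var_distribution_eq by auto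
  have at_k[measurable]: "(\<lambda>s. s k) \<in> measurable (\<Pi>\<^sub>M i\<in>{k}. D) D"
    by (rule measurable_component_singleton) auto
  have now_k: "now \<omega> k = \<xi> k \<omega>" for \<omega> by (simp add: now_def)
  have \<xi>: "\<xi> k = (\<lambda>s. s k) \<circ> now" by (auto simp: now_k)
  have "(\<lambda>\<omega>. F (past k \<omega>)) \<in> measurable M N" using F by measurable
  then show Ym: "Y k \<in> measurable M N" by (subst measurable_cong[OF YF]) auto
  have distY: "distr M N (Y k) = distr (distr M (\<Pi>\<^sub>M i\<in>{..<k}. D) (past k)) N F"
    using F by (subst distr_distr) (auto intro!: distr_cong simp: YF)
  have dist\<xi>: "distr M D (\<xi> k) = distr (distr M (\<Pi>\<^sub>M i\<in>{k}. D) now) D (\<lambda>s. s k)"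
    unfolding \<xi> by (rule distr_distr[symmetric]) simp_all
  have "prob_space (distr (distr M (\<Pi>\<^sub>M i\<in>{k}. D) now) D (\<lambda>s. s k))"
    by (intro prob_space.prob_space_distr prob_space_distr) simp_all
  then have "sigma_finite_measure (distr (distr M (\<Pi>\<^sub>M i\<in>{k}. D) now) D (\<lambda>s. s k))"
    by (rule prob_space_imp_sigma_finite)
  then have "distr M N (Y k) \<Otimes>\<^sub>M distr M D (\<xi> k)
      = distr (distr M (\<Pi>\<^sub>M i\<in>{..<k}. D) (past k) \<Otimes>\<^sub>M distr M (\<Pi>\<^sub>M i\<in>{k}. D) now)
          (N \<Otimes>\<^sub>M D) (\<lambda>(a, b). (F a, b k))"
    unfolding distY dist\<xi> using F by (intro pair_measure_distr) simp_all
  also have "\<dots> = distr M (N \<Otimes>\<^sub>M D) (\<lambda>\<omega>. (Y k \<omega>, \<xi> k \<omega>))"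
    unfolding joint using F by (subst distr_distr) (auto intro!: distr_cong simp: YF now_k)
  finally show "distr M N (Y k) \<Otimes>\<^sub>M distr M D (\<xi> k) = distr M (N \<Otimes>\<^sub>M D) (\<lambda>\<omega>. (Y k \<omega>, \<xi> k \<omega>))" .
qed

section \<open>Moments of the momentum error\<close>

text \<open>The cross term of \<open>norm_powr_add_le\<close> integrates to zero since the oracle is unbiased.\<close>

lemma oracle_noise_moment_le:
  fixes g :: "real ^ 'n \<Rightarrow> 'b \<Rightarrow> real ^ 'n"
  assumes unbiased: "unbiased_oracle D g nabla_f \<sigma> p" and p: "1 < p" "p \<le> 2" and t: "0 \<le> t"
  shows "(\<integral>\<^sup>+s. ennreal (norm (a + t *\<^sub>R (g x s - nabla_f x)) powr p) \<partial>D)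
      \<le> ennreal (norm a powr p) + ennreal (6 * t powr p * \<sigma> powr p)"
proof -
  interpret D: prob_space D using unbiased by (simp add: unbiased_oracle_def)
  have int[simp]: "integrable D (g x)" and mean: "(\<integral>s. g x s \<partial>D) = nabla_f x"
    and intp: "integrable D (\<lambda>s. norm (g x s - nabla_f x) powr p)"
    and mom: "(\<integral>s. norm (g x s - nabla_f x) powr p \<partial>D) \<le> \<sigma> powr p"
    using unbiased by (auto simp: unbiased_oracle_def)
  obtain w where w: "\<And>b. norm (a + b) powr p \<le> norm a powr p + w * (a \<bullet> b) + 6 * norm b powr p"
    using norm_powr_add_le[OF p, of a] by blast
  define R where "R s = norm a powr p + w * t * (a \<bullet> (g x s - nabla_f x))
     + 6 * t powr p * norm (g x s - nabla_f x) powr p" for s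
  have le: "norm (a + t *\<^sub>R (g x s - nabla_f x)) powr p \<le> R s" for s
    using w[of "t *\<^sub>R (g x s - nabla_f x)"] t by (simp add: R_def powr_mult mult_ac)
  have intR: "integrable D R" unfolding R_def using intp by simp
  have "(\<integral>\<^sup>+s. ennreal (norm (a + t *\<^sub>R (g x s - nabla_f x)) powr p) \<partial>D) \<le> (\<integral>\<^sup>+s. ennreal (R s) \<partial>D)"
    by (intro nn_integral_mono ennreal_leI le)
  also have "\<dots> = ennreal (\<integral>s. R s \<partial>D)"
    using intR order_trans[OF powr_ge_zero le] by (intro nn_integral_eq_integral) auto
  also have "(\<integral>s. a \<bullet> (g x s - nabla_f x) \<partial>D) = a \<bullet> (\<integral>s. (g x s - nabla_f x) \<partial>D)"
    by (rule integral_inner_right) simp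
  then have "(\<integral>s. a \<bullet> (g x s - nabla_f x) \<partial>D) = 0"
    using D.prob_space by (simp add: mean)
  then have "(\<integral>s. R s \<partial>D) = norm a powr p + 6 * t powr p * (\<integral>s. norm (g x s - nabla_f x) powr p \<partial>D)"
    unfolding R_def using intp D.prob_space by simp
  also have "\<dots> \<le> norm a powr p + 6 * t powr p * \<sigma> powr p"
    using mom by (intro add_left_mono mult_left_mono) auto
  finally show ?thesis by (simp add: ennreal_leI flip: ennreal_plus)
qed

text \<open>By independence the law of \<open>(Y, \<xi>)\<close> is a product, so the sample can be integrated out
  first, with \<open>Y\<close> held fixed.\<close>

lemma (in prob_space) indep_oracle_noise_moment_le:
  fixes g :: "real ^ 'n \<Rightarrow> 'b \<Rightarrow> real ^ 'n"
  assumes unbiased: "unbiased_oracle D g nabla_f \<sigma> p" and p: "1 < p" "p \<le> 2" and t: "0 \<le> t"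
    and meas: "nabla_f \<in> borel_measurable borel"
    and Y[measurable]: "Y \<in> measurable M N" and \<xi>[measurable]: "\<xi> \<in> measurable M D"
    and law: "distr M D \<xi> = D"
    and indep: "distr M N Y \<Otimes>\<^sub>M distr M D \<xi> = distr M (N \<Otimes>\<^sub>M D) (\<lambda>\<omega>. (Y \<omega>, \<xi> \<omega>))"
    and X[measurable]: "X \<in> borel_measurable N" and A[measurable]: "A \<in> borel_measurable N"
  shows "(\<integral>\<^sup>+\<omega>. ennreal (norm (A (Y \<omega>) + t *\<^sub>R (g (X (Y \<omega>)) (\<xi> \<omega>) - nabla_f (X (Y \<omega>)))) powr p) \<partial>M)
      \<le> (\<integral>\<^sup>+\<omega>. ennreal (norm (A (Y \<omega>)) powr p) \<partial>M) + ennreal (6 * t powr p * \<sigma> powr p)"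
proof -
  interpret D: prob_space D using unbiased by (simp add: unbiased_oracle_def)
  note meas[measurable]
  have g: "(\<lambda>(x, s). g x s) \<in> borel_measurable (borel \<Otimes>\<^sub>M D)"
    using unbiased by (simp add: unbiased_oracle_def)
  have [measurable]: "(\<lambda>z. g (X (fst z)) (snd z)) \<in> borel_measurable (N \<Otimes>\<^sub>M D)"
    using measurable_compose[OF _ g, of "\<lambda>z. (X (fst z), snd z)" "N \<Otimes>\<^sub>M D"] by simp
  have joint: "distr M N Y \<Otimes>\<^sub>M D = distr M (N \<Otimes>\<^sub>M D) (\<lambda>\<omega>. (Y \<omega>, \<xi> \<omega>))"
    using indep unfolding law .
  interpret Y: prob_space "distr M N Y" by (rule prob_space_distr) simp
  define G where "G z = ennreal (norm (A (fst z) + t *\<^sub>R (g (X (fst z)) (snd z) - nabla_f (X (fst z)))) powr p)" for z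
  have [measurable]: "G \<in> borel_measurable (N \<Otimes>\<^sub>M D)" unfolding G_def by measurable
  have "(\<integral>\<^sup>+\<omega>. ennreal (norm (A (Y \<omega>) + t *\<^sub>R (g (X (Y \<omega>)) (\<xi> \<omega>) - nabla_f (X (Y \<omega>)))) powr p) \<partial>M)
      = (\<integral>\<^sup>+\<omega>. G (Y \<omega>, \<xi> \<omega>) \<partial>M)" by (simp add: G_def)
  also have "\<dots> = (\<integral>\<^sup>+z. G z \<partial>(distr M (N \<Otimes>\<^sub>M D) (\<lambda>\<omega>. (Y \<omega>, \<xi> \<omega>))))"
    by (subst nn_integral_distr) auto
  also have "\<dots> = (\<integral>\<^sup>+y. (\<integral>\<^sup>+s. G (y, s) \<partial>D) \<partial>(distr M N Y))"
    unfolding joint[symmetric] by (rule D.nn_integral_fst[symmetric]) simp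
  also have "\<dots> \<le> (\<integral>\<^sup>+y. (ennreal (norm (A y) powr p) + ennreal (6 * t powr p * \<sigma> powr p)) \<partial>(distr M N Y))"
    unfolding G_def fst_conv snd_conv by (intro nn_integral_mono oracle_noise_moment_le[OF unbiased p t])
  also have "\<dots> = (\<integral>\<^sup>+y. ennreal (norm (A y) powr p) \<partial>(distr M N Y)) + ennreal (6 * t powr p * \<sigma> powr p)"
    using Y.emeasure_space_1 by (subst nn_integral_add) auto
  also have "(\<integral>\<^sup>+y. ennreal (norm (A y) powr p) \<partial>(distr M N Y)) = (\<integral>\<^sup>+\<omega>. ennreal (norm (A (Y \<omega>)) powr p) \<partial>M)"
    by (subst nn_integral_distr) auto
  finally show ?thesis .
qed

lemma momentum_run_step_norm_le:
  fixes x :: "nat \<Rightarrow> 'w \<Rightarrow> 'a::real_normed_vector"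
  assumes run: "momentum_run M \<xi> g \<Psi> \<alpha> \<gamma> \<delta> x0 x d" and "\<omega> \<in> space M" "\<gamma> \<ge> 0" "\<delta> > 0"
    and \<Psi>: "\<forall>y. norm y \<le> 1 \<longrightarrow> norm (\<Psi> y) \<le> B"
  shows "norm (x (Suc k) \<omega> - x k \<omega>) \<le> \<gamma> * B"
proof -
  have "0 < norm (d k \<omega>) + \<delta>" using assms by (simp add: add_nonneg_pos)
  then have "norm (d k \<omega> /\<^sub>R (norm (d k \<omega>) + \<delta>)) \<le> 1"
    using assms by (simp add: divide_inverse[symmetric] mult.commute[of "inverse _"])
  then have "norm (\<Psi> (d k \<omega> /\<^sub>R (norm (d k \<omega>) + \<delta>))) \<le> B" using \<Psi> by simp
  moreover have "x (Suc k) \<omega> - x k \<omega> = - (\<gamma> *\<^sub>R \<Psi> (d k \<omega> /\<^sub>R (norm (d k \<omega>) + \<delta>)))"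
    using run assms by (simp add: momentum_run_def)
  ultimately show ?thesis using assms by (simp add: mult_left_mono)
qed

text \<open>The three terms are the initial error, forgotten geometrically, the drift of the gradient, of size
  \<open>L * (\<gamma> * B)\<close> per step and accumulated over about \<open>1 / \<alpha>\<close> steps, and the averaged noise.\<close>

lemma momentum_error_moment_le:
  fixes g :: "real ^ 'n \<Rightarrow> 'b \<Rightarrow> real ^ 'n" and x :: "nat \<Rightarrow> 'w \<Rightarrow> real ^ 'n"
  assumes unbiased: "unbiased_oracle D g nabla_f \<sigma> p" and p: "1 < p" "p \<le> 2"
    and iid: "iid_samples M D \<xi>"
    and run: "momentum_run M \<xi> g \<Psi> \<alpha> \<gamma> \<delta> x0 x d"
    and \<alpha>: "0 < \<alpha>" "\<alpha> \<le> 1" and \<gamma>: "0 \<le> \<gamma>" and \<delta>: "0 < \<delta>"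
    and \<Psi>: "\<Psi> \<in> borel_measurable borel" "\<forall>y. norm y \<le> 1 \<longrightarrow> norm (\<Psi> y) \<le> B"
    and meas: "nabla_f \<in> borel_measurable borel"
    and Lip: "\<And>x y. norm (nabla_f x - nabla_f y) \<le> L * norm (x - y)" and L: "0 \<le> L"
  shows "x k \<in> borel_measurable M" "d k \<in> borel_measurable M"
    "(\<integral>\<^sup>+\<omega>. ennreal (norm (d k \<omega> - nabla_f (x k \<omega>)) powr p) \<partial>M)
      \<le> ennreal ((1 - \<alpha>) ^ k * (6 * \<sigma> powr p) + (L * (\<gamma> * B) / \<alpha>) powr p + 6 * \<alpha> powr (p - 1) * \<sigma> powr p)"
proof -
  have "prob_space M" and ind: "prob_space.indep_vars M (\<lambda>_. D) \<xi> UNIV" and law: "\<And>k. distr M D (\<xi> k) = D"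
    using iid by (auto simp: iid_samples_def)
  interpret prob_space M by fact
  note meas[measurable] \<Psi>(1)[measurable]
  have g[measurable]: "(\<lambda>(x, s). g x s) \<in> borel_measurable (borel \<Otimes>\<^sub>M D)"
    using unbiased by (simp add: unbiased_oracle_def)
  have x0: "x 0 \<omega> = x0" and d0: "d 0 \<omega> = g x0 (\<xi> 0 \<omega>)"
    and xS: "x (Suc k) \<omega> = x k \<omega> - \<gamma> *\<^sub>R \<Psi> (d k \<omega> /\<^sub>R (norm (d k \<omega>) + \<delta>))"
    and dS: "d (Suc k) \<omega> = \<alpha> *\<^sub>R g (x (Suc k) \<omega>) (\<xi> (Suc k) \<omega>) + (1 - \<alpha>) *\<^sub>R d k \<omega>"
    if "\<omega> \<in> space M" for \<omega> k
    using run that by (auto simp: momentum_run_def)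
  have B: "0 \<le> B" using order_trans[OF norm_ge_zero \<Psi>(2)[rule_format, of 0]] by simp
  \<comment> \<open>Read as a momentum step of weight one from a zero buffer, the initial step follows the same
    recursion as the others.\<close>
  define w where "w k = (if k = 0 then 1 else \<alpha>)" for k :: nat
  define buf where "buf k \<omega> = (if k = 0 then 0 else d (k - 1) \<omega>)" for k \<omega>
  have dw: "d k \<omega> = w k *\<^sub>R g (x k \<omega>) (\<xi> k \<omega>) + (1 - w k) *\<^sub>R buf k \<omega>" if "\<omega> \<in> space M" for k \<omega>
    using that by (cases k) (auto simp: w_def buf_def x0 d0 dS)
  have w: "0 \<le> w k" for k using \<alpha> by (simp add: w_def)
  define N :: "((real ^ 'n) \<times> (real ^ 'n)) measure" where "N = borel \<Otimes>\<^sub>M borel"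
  define Y where "Y k \<omega> = (x k \<omega>, buf k \<omega>)" for k \<omega>
  define dir where "dir k y s = w k *\<^sub>R g (fst y) s + (1 - w k) *\<^sub>R snd y" for k s and y :: "(real ^ 'n) \<times> (real ^ 'n)"
  define h where "h k y s = (fst y - \<gamma> *\<^sub>R \<Psi> (dir k y s /\<^sub>R (norm (dir k y s) + \<delta>)), dir k y s)"
    for k s and y :: "(real ^ 'n) \<times> (real ^ 'n)"
  have [measurable]: "(\<lambda>(y, s). g (fst y) s) \<in> borel_measurable (N \<Otimes>\<^sub>M D)"
    using measurable_compose[OF _ g, of "\<lambda>z. (fst (fst z), snd z)" "N \<Otimes>\<^sub>M D"]
    by (simp add: N_def split_beta')
  have dir[measurable]: "(\<lambda>(y, s). dir k y s) \<in> borel_measurable (N \<Otimes>\<^sub>M D)" for k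
  proof -
    have [measurable]: "(\<lambda>z. snd (fst z)) \<in> borel_measurable (N \<Otimes>\<^sub>M D)"
      unfolding N_def by measurable
    show ?thesis unfolding dir_def split_beta' by measurable
  qed
  have h: "(\<lambda>(y, s). h k y s) \<in> measurable (N \<Otimes>\<^sub>M D) N" for k
  proof -
    have [measurable]: "(\<lambda>z. fst (fst z)) \<in> borel_measurable (N \<Otimes>\<^sub>M D)"
      unfolding N_def by measurable
    have [measurable]: "(\<lambda>z. dir k (fst z) (snd z)) \<in> borel_measurable (N \<Otimes>\<^sub>M D)"
      using dir[of k] by (simp add: split_beta')
    show ?thesis unfolding h_def split_beta' by (subst (2) N_def) measurable
  qed
  have N0: "(x0, 0) \<in> space N" by (simp add: N_def space_pair_measure)
  have Y0: "Y 0 \<omega> = (x0, 0)" if "\<omega> \<in> space M" for \<omega>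
    using that by (simp add: Y_def buf_def x0)
  have YS: "Y (Suc k) \<omega> = h k (Y k \<omega>) (\<xi> k \<omega>)" if "\<omega> \<in> space M" for k \<omega>
    using dw[OF that, of k] xS[OF that, of k] by (simp add: Y_def h_def dir_def buf_def)
  note state = adapted_state_indep_next[where h = h and Y = Y, OF ind h N0 Y0 YS]
  have Ym: "Y k \<in> measurable M N" for k by (rule state)
  have indY: "distr M N (Y k) \<Otimes>\<^sub>M distr M D (\<xi> k)
      = distr M (N \<Otimes>\<^sub>M D) (\<lambda>\<omega>. (Y k \<omega>, \<xi> k \<omega>))" for k by (rule state)
  have \<xi>m: "\<xi> k \<in> measurable M D" for k using ind unfolding indep_vars_def by auto
  show xm: "x k \<in> borel_measurable M" for k
    using measurable_compose[OF Ym[of k, unfolded N_def] measurable_fst] by (simp add: Y_def)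
  show dm: "d k \<in> borel_measurable M" for k
    using measurable_compose[OF Ym[of "Suc k", unfolded N_def] measurable_snd] by (simp add: Y_def buf_def)
  define q where "q k = (\<integral>\<^sup>+\<omega>. ennreal (norm (d k \<omega> - nabla_f (x k \<omega>)) powr p) \<partial>M)" for k
  have noise: "q k \<le> (\<integral>\<^sup>+\<omega>. ennreal (norm ((1 - w k) *\<^sub>R (buf k \<omega> - nabla_f (x k \<omega>))) powr p) \<partial>M)
      + ennreal (6 * w k powr p * \<sigma> powr p)" for k
  proof -
    define A where "A y = (1 - w k) *\<^sub>R (snd y - nabla_f (fst y))" for y :: "(real ^ 'n) \<times> (real ^ 'n)"
    have "A \<in> borel_measurable N" "fst \<in> borel_measurable N"
      unfolding A_def N_def by measurable
    from indep_oracle_noise_moment_le[OF unbiased p w meas Ym \<xi>m law indY this(2,1), of k k]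
    have "(\<integral>\<^sup>+\<omega>. ennreal (norm (A (Y k \<omega>) + w k *\<^sub>R (g (x k \<omega>) (\<xi> k \<omega>) - nabla_f (x k \<omega>))) powr p) \<partial>M)
      \<le> (\<integral>\<^sup>+\<omega>. ennreal (norm (A (Y k \<omega>)) powr p) \<partial>M) + ennreal (6 * w k powr p * \<sigma> powr p)"
      by (simp add: Y_def)
    moreover have "q k = (\<integral>\<^sup>+\<omega>. ennreal (norm (A (Y k \<omega>) + w k *\<^sub>R (g (x k \<omega>) (\<xi> k \<omega>) - nabla_f (x k \<omega>))) powr p) \<partial>M)"
      unfolding q_def
      by (intro nn_integral_cong arg_cong[where f = "\<lambda>v. ennreal (norm v powr p)"])
         (simp add: dw A_def Y_def algebra_simps)
    ultimately show ?thesis by (simp add: A_def Y_def)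
  qed
  define \<rho> where "\<rho> = L * (\<gamma> * B) / \<alpha>"
  have \<rho>: "0 \<le> \<rho>" using L B \<alpha> \<gamma> by (simp add: \<rho>_def)
  define V where "V = \<rho> powr p + 6 * \<alpha> powr (p - 1) * \<sigma> powr p"
  have V: "0 \<le> V" by (simp add: V_def)
  have \<alpha>V: "\<alpha> * V = \<alpha> * \<rho> powr p + 6 * \<alpha> powr p * \<sigma> powr p"
    using \<alpha> by (simp add: V_def powr_diff algebra_simps)
  have rec: "q (Suc k) \<le> ennreal (1 - \<alpha>) * q k + ennreal (\<alpha> * V)" for k
  proof -
    \<comment> \<open>Reading the drift as \<open>\<alpha> * (drift / \<alpha>)\<close> exhibits a convex combination.\<close>
    have "norm ((1 - \<alpha>) *\<^sub>R (d k \<omega> - nabla_f (x (Suc k) \<omega>))) powr p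
        \<le> (1 - \<alpha>) * norm (d k \<omega> - nabla_f (x k \<omega>)) powr p + \<alpha> * \<rho> powr p"
      if \<omega>: "\<omega> \<in> space M" for \<omega>
    proof -
      define drift where "drift = norm (nabla_f (x k \<omega>) - nabla_f (x (Suc k) \<omega>))"
      have "drift \<le> L * (\<gamma> * B)"
        using order_trans[OF Lip[of "x (Suc k) \<omega>" "x k \<omega>"]
            mult_left_mono[OF momentum_run_step_norm_le[OF run \<omega> \<gamma> \<delta> \<Psi>(2), of k] L]]
        by (simp add: drift_def norm_minus_commute[of "nabla_f (x k \<omega>)"])
      then have "(1 - \<alpha>) * drift \<le> 1 * (\<alpha> * \<rho>)"
        using \<alpha> by (intro mult_mono) (auto simp: drift_def \<rho>_def)
      moreover have "norm (d k \<omega> - nabla_f (x (Suc k) \<omega>)) \<le> norm (d k \<omega> - nabla_f (x k \<omega>)) + drift"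
        using norm_triangle_ineq[of "d k \<omega> - nabla_f (x k \<omega>)" "nabla_f (x k \<omega>) - nabla_f (x (Suc k) \<omega>)"]
        by (simp add: drift_def)
      then have "(1 - \<alpha>) * norm (d k \<omega> - nabla_f (x (Suc k) \<omega>))
          \<le> (1 - \<alpha>) * (norm (d k \<omega> - nabla_f (x k \<omega>)) + drift)"
        using \<alpha> by (intro mult_left_mono) auto
      ultimately have "norm ((1 - \<alpha>) *\<^sub>R (d k \<omega> - nabla_f (x (Suc k) \<omega>)))
          \<le> (1 - \<alpha>) * norm (d k \<omega> - nabla_f (x k \<omega>)) + \<alpha> * \<rho>"
        using \<alpha> unfolding norm_scaleR by (simp add: distrib_left)
      then have "norm ((1 - \<alpha>) *\<^sub>R (d k \<omega> - nabla_f (x (Suc k) \<omega>))) powr p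
          \<le> ((1 - \<alpha>) * norm (d k \<omega> - nabla_f (x k \<omega>)) + \<alpha> * \<rho>) powr p"
        using p by (intro powr_mono2) auto
      also have "\<dots> \<le> (1 - \<alpha>) * norm (d k \<omega> - nabla_f (x k \<omega>)) powr p + \<alpha> * \<rho> powr p"
        using p \<alpha> \<rho> by (intro powr_convex_combination_le) auto
      finally show ?thesis .
    qed
    then have "(\<integral>\<^sup>+\<omega>. ennreal (norm ((1 - \<alpha>) *\<^sub>R (d k \<omega> - nabla_f (x (Suc k) \<omega>))) powr p) \<partial>M)
        \<le> (\<integral>\<^sup>+\<omega>. (ennreal (1 - \<alpha>) * ennreal (norm (d k \<omega> - nabla_f (x k \<omega>)) powr p) + ennreal (\<alpha> * \<rho> powr p)) \<partial>M)"
      using \<alpha> by (intro nn_integral_mono) (simp add: ennreal_leI flip: ennreal_mult ennreal_plus)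
    also have "\<dots> = ennreal (1 - \<alpha>) * q k + ennreal (\<alpha> * \<rho> powr p)"
      using xm[of k, measurable] dm[of k, measurable] emeasure_space_1
      by (subst nn_integral_add) (auto simp: q_def nn_integral_cmult)
    finally have "q (Suc k) \<le> ennreal (1 - \<alpha>) * q k + ennreal (\<alpha> * \<rho> powr p)
        + ennreal (6 * \<alpha> powr p * \<sigma> powr p)"
      using noise[of "Suc k"] by (simp add: w_def buf_def) (meson add_right_mono order_trans)
    then show ?thesis using \<alpha> by (simp add: \<alpha>V add.assoc flip: ennreal_plus)
  qed
  have "q k \<le> ennreal ((1 - \<alpha>) ^ k * (6 * \<sigma> powr p) + V)" for k
  proof (induction k)
    case 0
    have "q 0 \<le> ennreal (6 * \<sigma> powr p)" using noise[of 0] by (simp add: w_def)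
    also have "\<dots> \<le> ennreal ((1 - \<alpha>) ^ 0 * (6 * \<sigma> powr p) + V)" using V by (intro ennreal_leI) simp
    finally show ?case .
  next
    case (Suc k)
    have "q (Suc k) \<le> ennreal (1 - \<alpha>) * ennreal ((1 - \<alpha>) ^ k * (6 * \<sigma> powr p) + V) + ennreal (\<alpha> * V)"
      by (rule order_trans[OF rec]) (intro add_right_mono mult_left_mono Suc.IH, simp)
    also have "\<dots> = ennreal ((1 - \<alpha>) * ((1 - \<alpha>) ^ k * (6 * \<sigma> powr p) + V) + \<alpha> * V)"
      using \<alpha> V by (simp flip: ennreal_mult ennreal_plus)
    also have "(1 - \<alpha>) * ((1 - \<alpha>) ^ k * (6 * \<sigma> powr p) + V) + \<alpha> * V = (1 - \<alpha>) ^ Suc k * (6 * \<sigma> powr p) + V"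
      by (simp add: algebra_simps)
    finally show ?case .
  qed
  then show "(\<integral>\<^sup>+\<omega>. ennreal (norm (d k \<omega> - nabla_f (x k \<omega>)) powr p) \<partial>M)
      \<le> ennreal ((1 - \<alpha>) ^ k * (6 * \<sigma> powr p) + (L * (\<gamma> * B) / \<alpha>) powr p + 6 * \<alpha> powr (p - 1) * \<sigma> powr p)"
    by (simp add: q_def V_def \<rho>_def add.assoc)
qed

section \<open>The average gradient norm of a momentum run\<close>

text \<open>The values of \<open>f\<close> telescope along each path, before any expectation is taken. The gradient is
  replaced by \<open>d k\<close> in the inner product with the step at the cost \<open>B * norm (e k)\<close>, and in the resulting lower bound
  \<open>c * norm (d k)\<close> at the cost \<open>c * norm (e k)\<close>, where \<open>e k = d k - nabla_f (x k)\<close>.\<close>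

lemma momentum_run_gradient_sum_le:
  fixes x :: "nat \<Rightarrow> 'w \<Rightarrow> 'a::real_inner"
  assumes smooth: "lipschitz_smooth_with_gradient L f nabla_f" and L: "0 \<le> L"
    and lower: "\<And>y. fl \<le> f y"
    and run: "momentum_run M \<xi> g \<Psi> \<alpha> \<gamma> \<delta> x0 x d" and \<omega>: "\<omega> \<in> space M"
    and \<gamma>: "0 \<le> \<gamma>" and \<delta>: "0 < \<delta>" and c: "0 \<le> c"
    and \<Psi>_le: "\<forall>y. norm y \<le> 1 \<longrightarrow> norm (\<Psi> y) \<le> B"
    and \<Psi>_ge: "\<forall>y. norm y \<le> 1 \<longrightarrow> c * (norm y)\<^sup>2 \<le> y \<bullet> \<Psi> y"
  shows "\<gamma> * c * (\<Sum>k<T. norm (nabla_f (x k \<omega>)))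
    \<le> f x0 - fl + real T * (\<gamma> * c * \<delta> + L * (\<gamma> * B)\<^sup>2)
      + \<gamma> * (B + c) * (\<Sum>k<T. norm (d k \<omega> - nabla_f (x k \<omega>)))"
proof -
  have step: "\<gamma> * c * norm (nabla_f (x k \<omega>)) \<le> f (x k \<omega>) - f (x (Suc k) \<omega>)
      + (\<gamma> * c * \<delta> + L * (\<gamma> * B)\<^sup>2) + \<gamma> * (B + c) * norm (d k \<omega> - nabla_f (x k \<omega>))" for k
  proof -
    define G where "G = nabla_f (x k \<omega>)"
    define e where "e = d k \<omega> - G"
    define u where "u = \<Psi> (d k \<omega> /\<^sub>R (norm (d k \<omega>) + \<delta>))"
    have "0 < norm (d k \<omega>) + \<delta>" using \<delta> by (simp add: add_nonneg_pos)
    then have u: "norm u \<le> B"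
      unfolding u_def using \<delta>
      by (intro \<Psi>_le[rule_format]) (simp add: divide_inverse[symmetric] mult.commute[of "inverse _"])
    have xS: "x (Suc k) \<omega> = x k \<omega> + (- (\<gamma> *\<^sub>R u))"
      using run \<omega> by (simp add: momentum_run_def u_def)
    have "(norm (- (\<gamma> *\<^sub>R u)))\<^sup>2 \<le> (\<gamma> * B)\<^sup>2"
      using \<gamma> u by (intro power_mono) (auto intro: mult_left_mono)
    then have "L * (norm (- (\<gamma> *\<^sub>R u)))\<^sup>2 \<le> L * (\<gamma> * B)\<^sup>2" using L by (intro mult_left_mono)
    with lipschitz_smooth_descent[OF smooth, of "x k \<omega>" "- (\<gamma> *\<^sub>R u)"]
    have descent: "\<gamma> * (G \<bullet> u) \<le> f (x k \<omega>) - f (x (Suc k) \<omega>) + L * (\<gamma> * B)\<^sup>2"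
      by (simp add: xS G_def)
    have "e \<bullet> u \<le> norm e * B"
      using norm_cauchy_schwarz[of e u] mult_left_mono[OF u norm_ge_zero[of e]] by linarith
    moreover have "c * (norm (d k \<omega>) - \<delta>) \<le> d k \<omega> \<bullet> u"
      unfolding u_def by (rule normalized_inner_ge[OF \<delta> c \<Psi>_ge])
    moreover have "norm G - norm e \<le> norm (d k \<omega>)"
      using norm_triangle_ineq4[of "d k \<omega>" e] by (simp add: e_def)
    then have "c * (norm G - norm e) \<le> c * norm (d k \<omega>)" using c by (rule mult_left_mono)
    moreover have "G \<bullet> u = d k \<omega> \<bullet> u - e \<bullet> u" by (simp add: e_def inner_diff_left)
    ultimately have "c * norm G - c * \<delta> - (B + c) * norm e \<le> G \<bullet> u" by (simp add: algebra_simps)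
    then have "\<gamma> * (c * norm G - c * \<delta> - (B + c) * norm e) \<le> \<gamma> * (G \<bullet> u)"
      using \<gamma> by (rule mult_left_mono)
    with descent show ?thesis by (simp add: e_def G_def algebra_simps)
  qed
  have "\<gamma> * c * (\<Sum>k<T. norm (nabla_f (x k \<omega>)))
      \<le> (\<Sum>k<T. f (x k \<omega>) - f (x (Suc k) \<omega>)
      + (\<gamma> * c * \<delta> + L * (\<gamma> * B)\<^sup>2) + \<gamma> * (B + c) * norm (d k \<omega> - nabla_f (x k \<omega>)))"
    unfolding sum_distrib_left by (intro sum_mono step)
  also have "\<dots> = f (x 0 \<omega>) - f (x T \<omega>) + real T * (\<gamma> * c * \<delta> + L * (\<gamma> * B)\<^sup>2)
      + \<gamma> * (B + c) * (\<Sum>k<T. norm (d k \<omega> - nabla_f (x k \<omega>)))"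
    using sum_lessThan_telescope'[of "\<lambda>k. f (x k \<omega>)" T]
    by (simp add: sum.distrib flip: sum_distrib_left)
  also have "f (x 0 \<omega>) = f x0" using run \<omega> by (simp add: momentum_run_def)
  finally show ?thesis using lower[of "x T \<omega>"] by simp
qed

lemma (in prob_space) norm_mean_le_of_powr_moment:
  fixes Z :: "'a \<Rightarrow> 'c::{banach, second_countable_topology}"
  assumes [measurable]: "Z \<in> borel_measurable M"
    and p: "1 \<le> p" and r: "0 < r" and V: "0 \<le> V"
    and mom: "(\<integral>\<^sup>+\<omega>. ennreal (norm (Z \<omega>) powr p) \<partial>M) \<le> ennreal V"
  shows "integrable M (\<lambda>\<omega>. norm (Z \<omega>))" and "(\<integral>\<omega>. norm (Z \<omega>) \<partial>M) \<le> r + V / r powr (p - 1)"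
proof -
  have intp: "integrable M (\<lambda>\<omega>. norm (Z \<omega>) powr p)"
    using le_less_trans[OF mom ennreal_less_top] by (intro integrableI_bounded) auto
  have bound: "norm (Z \<omega>) \<le> r + norm (Z \<omega>) powr p / r powr (p - 1)" for \<omega>
    using r p by (intro le_add_powr_div) auto
  have int: "integrable M (\<lambda>\<omega>. r + norm (Z \<omega>) powr p / r powr (p - 1))" using intp by simp
  show I: "integrable M (\<lambda>\<omega>. norm (Z \<omega>))"
    by (rule Bochner_Integration.integrable_bound[OF int]) (use bound in \<open>auto intro: order_trans[OF _ abs_ge_self]\<close>)
  have "ennreal (\<integral>\<omega>. norm (Z \<omega>) powr p \<partial>M) \<le> ennreal V"
    using mom intp by (subst nn_integral_eq_integral[symmetric]) auto
  then have Vle: "(\<integral>\<omega>. norm (Z \<omega>) powr p \<partial>M) \<le> V" using V by (simp add: ennreal_le_iff)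
  have "(\<integral>\<omega>. norm (Z \<omega>) \<partial>M) \<le> (\<integral>\<omega>. r + norm (Z \<omega>) powr p / r powr (p - 1) \<partial>M)"
    by (intro integral_mono I int bound)
  also have "\<dots> = r + (\<integral>\<omega>. norm (Z \<omega>) powr p \<partial>M) / r powr (p - 1)"
    using intp prob_space by simp
  also have "\<dots> \<le> r + V / r powr (p - 1)"
    using Vle by (intro add_left_mono divide_right_mono) auto
  finally show "(\<integral>\<omega>. norm (Z \<omega>) \<partial>M) \<le> r + V / r powr (p - 1)" .
qed

text \<open>The parameters are still free here; \<open>r\<close> is the threshold of \<open>le_add_powr_div\<close>. The gradients along
  the run are integrable because after \<open>k\<close> steps of bounded length the point is at a bounded distance
  from \<open>x0\<close>.\<close>

lemma momentum_gradient_mean_le: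
  fixes g :: "real ^ 'n \<Rightarrow> 'b \<Rightarrow> real ^ 'n" and x :: "nat \<Rightarrow> 'w \<Rightarrow> real ^ 'n"
  assumes smooth: "lipschitz_smooth_with_gradient L f nabla_f" and L: "0 \<le> L"
    and lower: "\<And>y. fl \<le> f y"
    and unbiased: "unbiased_oracle D g nabla_f \<sigma> p" and p: "1 < p" "p \<le> 2"
    and iid: "iid_samples M D \<xi>"
    and run: "momentum_run M \<xi> g \<Psi> \<alpha> \<gamma> \<delta> x0 x d"
    and \<alpha>: "0 < \<alpha>" "\<alpha> \<le> 1" and \<gamma>: "0 < \<gamma>" and \<delta>: "0 < \<delta>" and c: "0 < c" and r: "0 < r"
    and \<Psi>m: "\<Psi> \<in> borel_measurable borel"
    and \<Psi>_le: "\<forall>y. norm y \<le> 1 \<longrightarrow> norm (\<Psi> y) \<le> B"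
    and \<Psi>_ge: "\<forall>y. norm y \<le> 1 \<longrightarrow> c * (norm y)\<^sup>2 \<le> y \<bullet> \<Psi> y"
    and T: "0 < T"
  shows "integrable M (\<lambda>\<omega>. norm (nabla_f (x k \<omega>)))"
    and "(\<Sum>k<T. \<integral>\<omega>. norm (nabla_f (x k \<omega>)) \<partial>M) / real T
      \<le> (f x0 - fl) / (c * (\<gamma> * real T)) + \<delta> + L * B\<^sup>2 * \<gamma> / c
        + (B / c + 1) * (r + (6 * \<sigma> powr p / (\<alpha> * real T) + (L * (\<gamma> * B) / \<alpha>) powr p
            + 6 * \<alpha> powr (p - 1) * \<sigma> powr p) / r powr (p - 1))"
proof -
  have "prob_space M" using iid by (simp add: iid_samples_def)
  interpret prob_space M by fact
  have Lip: "\<And>x y. norm (nabla_f x - nabla_f y) \<le> L * norm (x - y)"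
    and meas[measurable]: "nabla_f \<in> borel_measurable borel"
    using smooth by (auto simp: lipschitz_smooth_with_gradient_def intro: borel_measurable_continuous_onI)
  have B: "0 \<le> B" using order_trans[OF norm_ge_zero \<Psi>_le[rule_format, of 0]] by simp
  note err = momentum_error_moment_le[OF unbiased p iid run \<alpha> less_imp_le[OF \<gamma>] \<delta> \<Psi>m \<Psi>_le meas Lip L]
  note err(1)[measurable] err(2)[measurable]
  define V where "V = (L * (\<gamma> * B) / \<alpha>) powr p + 6 * \<alpha> powr (p - 1) * \<sigma> powr p"
  have Vk: "0 \<le> (1 - \<alpha>) ^ k * (6 * \<sigma> powr p) + V" for k using \<alpha> by (simp add: V_def)
  have mom: "(\<integral>\<^sup>+\<omega>. ennreal (norm (d k \<omega> - nabla_f (x k \<omega>)) powr p) \<partial>M)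
      \<le> ennreal ((1 - \<alpha>) ^ k * (6 * \<sigma> powr p) + V)" for k
    using err(3)[of k] by (simp add: V_def add.assoc)
  have em: "(\<lambda>\<omega>. d k \<omega> - nabla_f (x k \<omega>)) \<in> borel_measurable M" for k by measurable
  note mean = norm_mean_le_of_powr_moment[OF em less_imp_le[OF p(1)] r Vk mom]
  have dist: "norm (x k \<omega> - x0) \<le> real k * (\<gamma> * B)" if \<omega>: "\<omega> \<in> space M" for k \<omega>
  proof (induction k)
    case 0
    show ?case using run \<omega> by (simp add: momentum_run_def)
  next
    case (Suc k)
    have "norm (x (Suc k) \<omega> - x0) \<le> norm (x (Suc k) \<omega> - x k \<omega>) + norm (x k \<omega> - x0)"
      using norm_triangle_ineq[of "x (Suc k) \<omega> - x k \<omega>" "x k \<omega> - x0"] by simp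
    with Suc momentum_run_step_norm_le[OF run \<omega> less_imp_le[OF \<gamma>] \<delta> \<Psi>_le, of k]
    show ?case by (simp add: algebra_simps)
  qed
  show int: "integrable M (\<lambda>\<omega>. norm (nabla_f (x k \<omega>)))" for k
  proof (rule integrable_const_bound)
    have "norm (nabla_f (x k \<omega>)) \<le> norm (nabla_f x0) + L * (real k * (\<gamma> * B))" if "\<omega> \<in> space M" for \<omega>
      using Lip[of "x k \<omega>" x0] mult_left_mono[OF dist[OF that, of k] L]
        norm_triangle_ineq2[of "nabla_f (x k \<omega>)" "nabla_f x0"] by linarith
    then show "AE \<omega> in M. norm (norm (nabla_f (x k \<omega>))) \<le> norm (nabla_f x0) + L * (real k * (\<gamma> * B))"
      by (intro AE_I2) simp
  qed measurable
  define E where "E k = (\<integral>\<omega>. norm (d k \<omega> - nabla_f (x k \<omega>)) \<partial>M)" for k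
  define S where "S = (\<Sum>k<T. \<integral>\<omega>. norm (nabla_f (x k \<omega>)) \<partial>M)"
  define a where "a = f x0 - fl + real T * (\<gamma> * c * \<delta> + L * (\<gamma> * B)\<^sup>2)"
  have "\<gamma> * c * S = (\<integral>\<omega>. \<gamma> * c * (\<Sum>k<T. norm (nabla_f (x k \<omega>))) \<partial>M)"
    unfolding S_def using int by (simp add: Bochner_Integration.integral_sum)
  also have "\<dots> \<le> (\<integral>\<omega>. a + \<gamma> * (B + c) * (\<Sum>k<T. norm (d k \<omega> - nabla_f (x k \<omega>))) \<partial>M)"
  proof (rule integral_mono)
    show "\<gamma> * c * (\<Sum>k<T. norm (nabla_f (x k \<omega>)))
        \<le> a + \<gamma> * (B + c) * (\<Sum>k<T. norm (d k \<omega> - nabla_f (x k \<omega>)))" if "\<omega> \<in> space M" for \<omega>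
      unfolding a_def
      by (rule momentum_run_gradient_sum_le[OF smooth L lower run that less_imp_le[OF \<gamma>] \<delta> less_imp_le[OF c] \<Psi>_le \<Psi>_ge])
  qed (use int mean(1) in auto)
  also have "\<dots> = a + \<gamma> * (B + c) * (\<Sum>k<T. E k)"
    unfolding E_def using mean(1) prob_space by (simp add: Bochner_Integration.integral_sum)
  finally have main: "\<gamma> * c * S \<le> a + \<gamma> * (B + c) * (\<Sum>k<T. E k)" .
  have geo: "(\<Sum>k<T. (1 - \<alpha>) ^ k) \<le> 1 / \<alpha>"
    using \<alpha> by (simp add: sum_gp_strict divide_right_mono)
  have "(\<Sum>k<T. E k) \<le> (\<Sum>k<T. r + ((1 - \<alpha>) ^ k * (6 * \<sigma> powr p) + V) / r powr (p - 1))"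
    unfolding E_def by (intro sum_mono mean(2))
  also have "\<dots> = real T * r + ((\<Sum>k<T. (1 - \<alpha>) ^ k) * (6 * \<sigma> powr p) + real T * V) / r powr (p - 1)"
    by (simp add: sum.distrib flip: sum_divide_distrib sum_distrib_right)
  also have "\<dots> \<le> real T * r + (1 / \<alpha> * (6 * \<sigma> powr p) + real T * V) / r powr (p - 1)"
    using geo by (intro add_left_mono divide_right_mono add_right_mono mult_right_mono) auto
  also have "\<dots> = real T * (r + (6 * \<sigma> powr p / (\<alpha> * real T) + V) / r powr (p - 1))"
    using T \<alpha> r by (simp add: distrib_left add_divide_distrib)
  finally have sumE: "(\<Sum>k<T. E k) \<le> real T * (r + (6 * \<sigma> powr p / (\<alpha> * real T) + V) / r powr (p - 1))"
    (is "_ \<le> real T * ?Q") .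
  have "\<gamma> * c * S \<le> a + \<gamma> * (B + c) * (real T * ?Q)"
    by (rule order_trans[OF main], intro add_left_mono mult_left_mono sumE) (use \<gamma> B c in auto)
  then have "\<gamma> * c * S / (\<gamma> * c * real T) \<le> (a + \<gamma> * (B + c) * (real T * ?Q)) / (\<gamma> * c * real T)"
    using \<gamma> c T by (intro divide_right_mono) auto
  also have "\<gamma> * c * S / (\<gamma> * c * real T) = S / real T" using \<gamma> c by simp
  also have "(a + \<gamma> * (B + c) * (real T * q)) / (\<gamma> * c * real T)
      = (f x0 - fl) / (c * (\<gamma> * real T)) + \<delta> + L * B\<^sup>2 * \<gamma> / c + (B / c + 1) * q" for q
    using \<gamma> c T unfolding a_def by (simp add: field_simps power2_eq_square)
  finally show "(\<Sum>k<T. \<integral>\<omega>. norm (nabla_f (x k \<omega>)) \<partial>M) / real T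
      \<le> (f x0 - fl) / (c * (\<gamma> * real T)) + \<delta> + L * B\<^sup>2 * \<gamma> / c
        + (B / c + 1) * (r + (6 * \<sigma> powr p / (\<alpha> * real T) + (L * (\<gamma> * B) / \<alpha>) powr p
            + 6 * \<alpha> powr (p - 1) * \<sigma> powr p) / r powr (p - 1))"
    by (simp add: S_def V_def add.assoc)
qed

theorem theorem4p7:
  fixes f :: "real ^ 'n \<Rightarrow> real"
    and nabla_f :: "real ^ 'n \<Rightarrow> real ^ 'n"
    and D :: "'b measure"
    and g :: "real ^ 'n \<Rightarrow> 'b \<Rightarrow> real ^ 'n"
    and x0 :: "real ^ 'n"
    and L \<sigma> p \<kappa> \<epsilon> :: real
  assumes "L > 0"
    and "lipschitz_smooth_with_gradient L f nabla_f"
    and "bdd_below (range f)"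
    and "\<sigma> \<ge> 0" and "1 < p" and "p \<le> 2"
    and "unbiased_oracle D g nabla_f \<sigma> p"
    and "\<kappa> > 2" and "\<epsilon> > 0"
  shows "\<exists>C. \<forall>(K::nat) (\<delta>::real) (M::'w measure) (\<xi>::nat \<Rightarrow> 'w \<Rightarrow> 'b) x d.
    0 < \<delta> \<and> \<delta> \<le> (real K + 1) powr (- min (1/4) ((p - 1) / (2 * p))) \<and>
    iid_samples M D \<xi> \<and>
    momentum_run M \<xi> g (nabla_phi_conj \<kappa> \<epsilon>)
      ((real K + 1) powr (-1/2)) ((real K + 1) powr (-3/4)) \<delta> x0 x d \<longrightarrow>
    (\<forall>k\<le>K. integrable M (\<lambda>\<omega>. norm (nabla_f (x k \<omega>)))) \<and>
    1 / (real K + 1) * (\<Sum>k=0..K. \<integral>\<omega>. norm (nabla_f (x k \<omega>)) \<partial>M)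
      \<le> C * (real K + 1) powr (- min (1/4) ((p - 1) / (2 * p)))"
proof -
  note p = \<open>1 < p\<close> \<open>p \<le> 2\<close>
  obtain fl where fl: "\<And>y. fl \<le> f y"
    using assms(3) by (auto simp: bdd_below_def)
  define m where "m = min (1/4) ((p - 1) / (2 * p))"
  have m: "m \<le> 1/4" "p * m \<le> p / 4" "p * m \<le> (p - 1) / 2"
  proof -
    show "m \<le> 1/4" by (simp add: m_def)
    then show "p * m \<le> p / 4" using p by simp
    have "p * m \<le> p * ((p - 1) / (2 * p))" using p by (intro mult_left_mono) (auto simp: m_def)
    then show "p * m \<le> (p - 1) / 2" using p by simp
  qed
  define c where "c = 1 / (\<epsilon> powr \<kappa> + 1) powr (1 / \<kappa>)"
  define B where "B = 1 / \<epsilon>"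
  have c: "0 < c"
    unfolding c_def using powr_ge_zero[of \<epsilon> \<kappa>] by (intro divide_pos_pos) (auto simp del: powr_ge_zero)
  have B: "0 < B" using \<open>\<epsilon> > 0\<close> by (simp add: B_def)
  have \<Psi>_le: "\<forall>y :: real ^ 'n. norm y \<le> 1 \<longrightarrow> norm (nabla_phi_conj \<kappa> \<epsilon> y) \<le> B"
  proof (intro allI impI)
    fix y :: "real ^ 'n" assume "norm y \<le> 1"
    then show "norm (nabla_phi_conj \<kappa> \<epsilon> y) \<le> B"
      using norm_nabla_phi_conj_le[of \<kappa> \<epsilon> y] divide_right_mono[of "norm y" 1 \<epsilon>] assms(8,9)
      by (simp add: B_def)
  qed
  have \<Psi>_ge: "\<forall>y :: real ^ 'n. norm y \<le> 1 \<longrightarrow> c * (norm y)\<^sup>2 \<le> y \<bullet> nabla_phi_conj \<kappa> \<epsilon> y"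
  proof (intro allI impI)
    fix y :: "real ^ 'n" assume "norm y \<le> 1"
    then show "c * (norm y)\<^sup>2 \<le> y \<bullet> nabla_phi_conj \<kappa> \<epsilon> y"
      using inner_nabla_phi_conj_ge[of \<kappa> \<epsilon> y] assms(8,9) by (simp add: c_def)
  qed
  have \<Psi>m: "(nabla_phi_conj \<kappa> \<epsilon> :: real ^ 'n \<Rightarrow> _) \<in> borel_measurable borel"
    using assms(8,9) by (intro borel_measurable_nabla_phi_conj) auto
  define Q where "Q = 1 + (12 * \<sigma> powr p + (L * B) powr p)"
  define C where "C = (f x0 - fl) / c + 1 + L * B\<^sup>2 / c + (B / c + 1) * Q"
  show ?thesis
  proof (intro exI[of _ C] allI impI, elim conjE)
    fix K :: nat and \<delta> :: real and M :: "'w measure" and \<xi> :: "nat \<Rightarrow> 'w \<Rightarrow> 'b" and x d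
    assume \<delta>: "0 < \<delta>" "\<delta> \<le> (real K + 1) powr (- min (1/4) ((p - 1) / (2 * p)))"
      and iid: "iid_samples M D \<xi>"
      and run: "momentum_run M \<xi> g (nabla_phi_conj \<kappa> \<epsilon>)
        ((real K + 1) powr (-1/2)) ((real K + 1) powr (-3/4)) \<delta> x0 x d"
    define T where "T = Suc K"
    define t where "t = real T"
    have t: "1 \<le> t" "real K + 1 = t" by (simp_all add: t_def T_def)
    define \<alpha> where "\<alpha> = t powr (-1/2)"
    define \<gamma> where "\<gamma> = t powr (-3/4)"
    define r where "r = t powr (- m)"
    have \<alpha>: "0 < \<alpha>" "\<alpha> \<le> 1" and \<gamma>: "0 < \<gamma>" and r: "0 < r"
      using t powr_mono[of "-1/2" 0 t] by (auto simp: \<alpha>_def \<gamma>_def r_def)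
    note run' = run[unfolded t(2), folded \<alpha>_def \<gamma>_def]
    have T: "0 < T" by (simp add: T_def)
    note bound = momentum_gradient_mean_le[OF assms(2) less_imp_le[OF assms(1)] fl assms(7) p iid run'
        \<alpha> \<gamma> \<delta>(1) c r \<Psi>m \<Psi>_le \<Psi>_ge T]
    have mono: "t powr u \<le> t powr v" if "u \<le> v" for u v using t that by (intro powr_mono)
    have "\<gamma> * t = t powr (1/4)"
      using t powr_add[of t "-3/4" 1] by (simp add: \<gamma>_def)
    then have 1: "(f x0 - fl) / (c * (\<gamma> * t)) = (f x0 - fl) / c * t powr (-1/4)"
      by (simp add: powr_minus_divide)
    have 2: "(f x0 - fl) / c * t powr (-1/4) \<le> (f x0 - fl) / c * r"
      unfolding r_def using fl[of x0] c m by (intro mult_left_mono mono) auto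
    have 3: "\<delta> \<le> r" using \<delta>(2) by (simp add: r_def m_def t)
    have 4: "L * B\<^sup>2 * \<gamma> / c \<le> L * B\<^sup>2 / c * r"
    proof -
      have "\<gamma> \<le> r" unfolding \<gamma>_def r_def using m by (intro mono) auto
      then have "L * B\<^sup>2 / c * \<gamma> \<le> L * B\<^sup>2 / c * r"
        using assms(1) c by (intro mult_left_mono) auto
      then show ?thesis by simp
    qed
    \<comment> \<open>Since \<open>r = t powr (- m)\<close>, dividing \<open>t powr (- p * m)\<close> by \<open>r powr (p - 1)\<close> leaves \<open>r\<close>, so every
      part of the moment bound has to be compared with \<open>t powr (- p * m)\<close>.\<close>
    have 5: "r + (6 * \<sigma> powr p / (\<alpha> * t) + (L * (\<gamma> * B) / \<alpha>) powr p
        + 6 * \<alpha> powr (p - 1) * \<sigma> powr p) / r powr (p - 1) \<le> Q * r"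
    proof -
      have "1 / (\<alpha> * t) = t powr (-1/2)"
        using t powr_add[of t "-1/2" 1] by (simp add: \<alpha>_def powr_minus_divide)
      also have "\<dots> \<le> t powr (- p * m)" using m(3) p by (intro mono) auto
      finally have a: "6 * \<sigma> powr p / (\<alpha> * t) \<le> 6 * \<sigma> powr p * t powr (- p * m)"
        using mult_left_mono[of "1 / (\<alpha> * t)" _ "6 * \<sigma> powr p"] by simp
      have ratio: "\<gamma> / \<alpha> = t powr (-1/4)"
        unfolding \<gamma>_def \<alpha>_def powr_diff[symmetric] by simp
      have "L * (\<gamma> * B) / \<alpha> = (L * B) * (\<gamma> / \<alpha>)" by simp
      also have "\<dots> = (L * B) * t powr (-1/4)" unfolding ratio ..
      finally have "L * (\<gamma> * B) / \<alpha> = (L * B) * t powr (-1/4)" .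
      then have "(L * (\<gamma> * B) / \<alpha>) powr p = (L * B) powr p * t powr (- p / 4)"
        using assms(1) B by (simp add: powr_mult powr_powr)
      also have "\<dots> \<le> (L * B) powr p * t powr (- p * m)"
        using m(2) by (intro mult_left_mono mono) auto
      finally have b: "(L * (\<gamma> * B) / \<alpha>) powr p \<le> (L * B) powr p * t powr (- p * m)" .
      have "\<alpha> powr (p - 1) = t powr (- ((p - 1) / 2))" by (simp add: \<alpha>_def powr_powr)
      also have "\<dots> \<le> t powr (- p * m)" using m(3) by (intro mono) auto
      finally have "6 * \<sigma> powr p * \<alpha> powr (p - 1) \<le> 6 * \<sigma> powr p * t powr (- p * m)"
        by (intro mult_left_mono) auto
      with a b have "6 * \<sigma> powr p / (\<alpha> * t) + (L * (\<gamma> * B) / \<alpha>) powr p + 6 * \<alpha> powr (p - 1) * \<sigma> powr p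
          \<le> (Q - 1) * t powr (- p * m)"
        by (simp add: Q_def algebra_simps)
      then have "(6 * \<sigma> powr p / (\<alpha> * t) + (L * (\<gamma> * B) / \<alpha>) powr p + 6 * \<alpha> powr (p - 1) * \<sigma> powr p) / r powr (p - 1)
          \<le> (Q - 1) * t powr (- p * m) / r powr (p - 1)"
        by (intro divide_right_mono) auto
      also have "\<dots> = (Q - 1) * (t powr (- p * m) / t powr (- m * (p - 1)))"
        by (simp add: r_def powr_powr)
      also have "t powr (- p * m) / t powr (- m * (p - 1)) = r"
        unfolding powr_diff[symmetric] r_def by (simp add: algebra_simps)
      finally show ?thesis by (simp add: algebra_simps)
    qed
    have "(\<Sum>k<T. \<integral>\<omega>. norm (nabla_f (x k \<omega>)) \<partial>M) / t
        \<le> (f x0 - fl) / c * r + r + L * B\<^sup>2 / c * r + (B / c + 1) * (Q * r)"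
      using bound(2)[folded t_def] 1 2 3 4 mult_left_mono[OF 5, of "B / c + 1"] B c by simp
    also have "\<dots> = C * r" by (simp add: C_def algebra_simps)
    also have "(\<Sum>k<T. \<integral>\<omega>. norm (nabla_f (x k \<omega>)) \<partial>M) = (\<Sum>k=0..K. \<integral>\<omega>. norm (nabla_f (x k \<omega>)) \<partial>M)"
      by (simp add: T_def lessThan_Suc_atMost atLeast0AtMost)
    finally have "1 / (real K + 1) * (\<Sum>k=0..K. \<integral>\<omega>. norm (nabla_f (x k \<omega>)) \<partial>M)
        \<le> C * (real K + 1) powr (- min (1/4) ((p - 1) / (2 * p)))"
      by (simp add: t r_def m_def)
    with bound(1) show "(\<forall>k\<le>K. integrable M (\<lambda>\<omega>. norm (nabla_f (x k \<omega>)))) \<and>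
        1 / (real K + 1) * (\<Sum>k=0..K. \<integral>\<omega>. norm (nabla_f (x k \<omega>)) \<partial>M)
          \<le> C * (real K + 1) powr (- min (1/4) ((p - 1) / (2 * p)))" by blast
  qed
qed

end
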